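(* Let $(X,\mathcal{S})$ be an $S$-metric space, let $x_0\in X$, $r\in(0,\infty)$, and let $C_{x_0,r}^{S}$ be the circle centered at $x_0$ with radius $r$. Define $\varphi:X\to[0,\infty)$ by $\varphi(x)=\mathcal{S}(x,x,x_0)$ for all $x\in X$. Let $T:X\to X$ be a self-mapping, and for $x\in X$ put $U_x=\{T^n x:n\in\mathbb{N}\}$; assume $diam\{U_x\}<\infty$ for every $x\in X$. Suppose that $T$ satisfies $$\mathcal{S}(x,x,Tx)\leq \varphi(x)-\varphi(Tx)$$ and $$h\,\mathcal{S}(x,x,Tx)+\mathcal{S}(Tx,Tx,x_0)\geq r$$ for all $x\in C_{x_0,r}^{S}$ and some $h\in[0,1)$. If the contractive condition $$\mathcal{S}(Tx,Tx,Ty)<diam\{U_x\cup U_y\}$$ is satisfied by $T$ for all $x\in C_{x_0,r}^{S}$ and $y\in X\setminus C_{x_0,r}^{S}$, then $C_{x_0,r}^{S}$ is the unique fixed circle of $T$.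
   Context: An $S$-metric on a nonempty set $X$ is a function $\mathcal{S}:X^3\to[0,\infty)$ such that for all $x,y,z,a\in X$: (1) $\mathcal{S}(x,y,z)=0$ if and only if $x=y=z$; (2) $\mathcal{S}(x,y,z)\leq \mathcal{S}(x,x,a)+\mathcal{S}(y,y,a)+\mathcal{S}(z,z,a)$. The pair $(X,\mathcal{S})$ is then called an $S$-metric space. The diameter of a nonempty subset $A\subseteq X$ is $diam\{A\}=\sup\{\mathcal{S}(x,x,y):x,y\in A\}$. For $x_0\in X$ and $r\in(0,\infty)$, the circle centered at $x_0$ with radius $r$ is $C_{x_0,r}^{S}=\{x\in X:\mathcal{S}(x,x,x_0)=r\}$. For a self-mapping $T:X\to X$, a circle $C_{x_0,r}^{S}$ is said to be a fixed circle of $T$ if $Tx=x$ for all $x\in C_{x_0,r}^{S}$. $T^n$ denotes the $n$-th iterate of $T$.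
   Formalization: Literal uniqueness fails (empty circles, or a smaller circle inside the fixed one); so, for a nonempty circle C, uniqueness is proved among nonempty fixed circles that are not proper subsets of C or that themselves satisfy the contractive condition. *)

theory Defs
  imports Complex_Main "HOL-Library.Extended_Real" "HOL-Library.FuncSet"
begin

locale S_metric_space =
  fixes X :: "'a set" and S :: "'a \<Rightarrow> 'a \<Rightarrow> 'a \<Rightarrow> real"
  assumes nonempty: "X \<noteq> {}"
    and nonneg: "\<lbrakk>x \<in> X; y \<in> X; z \<in> X\<rbrakk> \<Longrightarrow> 0 \<le> S x y z"
    and zero_iff: "\<lbrakk>x \<in> X; y \<in> X; z \<in> X\<rbrakk> \<Longrightarrow> S x y z = 0 \<longleftrightarrow> x = y \<and> y = z"
    and triangle: "\<lbrakk>x \<in> X; y \<in> X; z \<in> X; a \<in> X\<rbrakk> \<Longrightarrow> S x y z \<le> S x x a + S y y a + S z z a"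

(* Extended-real valued, so that "diam < \<infinity>" is a genuine condition; only meant for nonempty A. *)
definition S_diam :: "('a \<Rightarrow> 'a \<Rightarrow> 'a \<Rightarrow> real) \<Rightarrow> 'a set \<Rightarrow> ereal" where
  "S_diam S A = Sup {ereal (S x x y) | x y. x \<in> A \<and> y \<in> A}"

definition S_circle :: "'a set \<Rightarrow> ('a \<Rightarrow> 'a \<Rightarrow> 'a \<Rightarrow> real) \<Rightarrow> 'a \<Rightarrow> real \<Rightarrow> 'a set" where
  "S_circle X S x0 r = {x \<in> X. S x x x0 = r}"

(* An empty circle is vacuously fixed. *)
definition fixed_circle ::
    "'a set \<Rightarrow> ('a \<Rightarrow> 'a \<Rightarrow> 'a \<Rightarrow> real) \<Rightarrow> ('a \<Rightarrow> 'a) \<Rightarrow> 'a \<Rightarrow> real \<Rightarrow> bool" where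
  "fixed_circle X S T x0 r \<longleftrightarrow> (\<forall>x \<in> S_circle X S x0 r. T x = x)"

(* U_x, with n = 0 included, so x itself belongs to U_x. *)
definition iterates :: "('a \<Rightarrow> 'a) \<Rightarrow> 'a \<Rightarrow> 'a set" where
  "iterates T x = {(T ^^ n) x | n. True}"

definition circle_contractive ::
    "'a set \<Rightarrow> ('a \<Rightarrow> 'a \<Rightarrow> 'a \<Rightarrow> real) \<Rightarrow> ('a \<Rightarrow> 'a) \<Rightarrow> 'a \<Rightarrow> real \<Rightarrow> bool" where
  "circle_contractive X S T x0 r \<longleftrightarrow>
     (\<forall>x \<in> S_circle X S x0 r. \<forall>y \<in> X - S_circle X S x0 r.
        ereal (S (T x) (T x) (T y)) < S_diam S (iterates T x \<union> iterates T y))"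

end

theory Submission
  imports Defs
begin

text \<open>
  On the circle, the two displayed inequalities squeeze \<open>S x x (T x)\<close> below \<open>h * S x x (T x)\<close>
  with \<open>h < 1\<close>, so this distance vanishes and \<open>T x = x\<close>.

  For uniqueness, the orbit of a fixed point is a singleton, so for two fixed points \<open>u\<close>, \<open>v\<close>
  the diameter of the united orbits is exactly \<open>S u u v\<close>, because an \<open>S\<close>-metric is symmetric in
  the sense of \<open>S u u v = S v v u\<close>. The strict contractive condition therefore fails for every
  pair of fixed points: a nonempty fixed circle that satisfies it contains all fixed points of
  \<open>T\<close>. Hence every other fixed circle is a subset of the given one. A proper subset is
  among the competitors only if it satisfies the contractive condition around its own centre,
  and then the same argument gives the reverse inclusion.
\<close>

context S_metric_space
begin

text \<open>Choosing the auxiliary point of the triangle inequality as \<open>x\<close> itself kills two of the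
  three terms on the right.\<close>

lemma S_symmetric:
  assumes "x \<in> X" "y \<in> X"
  shows "S x x y = S y y x"
proof -
  have "S u u v \<le> S v v u" if "u \<in> X" "v \<in> X" for u v
    using triangle[of u u v u] zero_iff[of u u u] that by simp
  then show ?thesis
    using assms by (meson antisym)
qed

lemma S_diam_pair:
  assumes "x \<in> X" "y \<in> X"
  shows "S_diam S {x, y} = ereal (S x x y)"
  unfolding S_diam_def
proof (rule antisym)
  have "S u u v \<le> S x x y" if "u \<in> {x, y}" "v \<in> {x, y}" for u v
    using that assms nonneg[of x x y] zero_iff[of x x x] zero_iff[of y y y] S_symmetric[of x y]
    by auto
  then show "Sup {ereal (S u u v) |u v. u \<in> {x, y} \<and> v \<in> {x, y}} \<le> ereal (S x x y)"
    by (intro Sup_least) auto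
  show "ereal (S x x y) \<le> Sup {ereal (S u u v) |u v. u \<in> {x, y} \<and> v \<in> {x, y}}"
    by (rule Sup_upper) blast
qed

end

lemma iterates_fixed_point:
  assumes "T x = x"
  shows "iterates T x = {x}"
proof -
  have "(T ^^ n) x = x" for n
    by (induction n) (use assms in simp_all)
  then show ?thesis
    by (simp add: iterates_def)
qed

text \<open>A fixed point \<open>y\<close> outside the circle, paired with any point \<open>x\<close> on it, would turn the
  contractive condition into \<open>S x x y < S x x y\<close>.\<close>

lemma (in S_metric_space) fixed_point_in_contractive_fixed_circle:
  assumes "fixed_circle X S T c r" "S_circle X S c r \<noteq> {}" "circle_contractive X S T c r"
    and "y \<in> X" "T y = y"
  shows "y \<in> S_circle X S c r"
proof (rule ccontr)
  assume "y \<notin> S_circle X S c r"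
  moreover obtain x where x: "x \<in> S_circle X S c r"
    using assms(2) by blast
  ultimately have "ereal (S (T x) (T x) (T y)) < S_diam S (iterates T x \<union> iterates T y)"
    using assms(3,4) by (simp add: circle_contractive_def)
  moreover have "T x = x" "x \<in> X"
    using x assms(1) by (simp_all add: fixed_circle_def S_circle_def)
  ultimately show False
    using assms(4,5) S_diam_pair[of x y] by (simp add: iterates_fixed_point insert_commute)
qed

lemma (in S_metric_space) fixed_circle_subset_contractive_fixed_circle:
  assumes "fixed_circle X S T c r" "S_circle X S c r \<noteq> {}" "circle_contractive X S T c r"
    and "fixed_circle X S T d s"
  shows "S_circle X S d s \<subseteq> S_circle X S c r"
  using fixed_point_in_contractive_fixed_circle[OF assms(1-3)] assms(4)
  by (auto simp: fixed_circle_def S_circle_def)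

lemma (in S_metric_space) fixed_circleI:
  assumes "T \<in> X \<rightarrow> X" "h < 1"
    and decrease: "\<And>x. x \<in> S_circle X S c r \<Longrightarrow> S x x (T x) \<le> S x x c - S (T x) (T x) c"
    and outside: "\<And>x. x \<in> S_circle X S c r \<Longrightarrow> h * S x x (T x) + S (T x) (T x) c \<ge> r"
  shows "fixed_circle X S T c r"
  unfolding fixed_circle_def
proof
  fix x assume x: "x \<in> S_circle X S c r"
  then have mem: "x \<in> X" "T x \<in> X" and "S x x c = r"
    using assms(1) by (auto simp: S_circle_def)
  then have "(1 - h) * S x x (T x) \<le> 0"
    using decrease[OF x] outside[OF x] by (simp add: algebra_simps)
  then have "S x x (T x) \<le> 0"
    using \<open>h < 1\<close> by (simp add: mult_le_0_iff)
  then have "S x x (T x) = 0"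
    using nonneg mem by (simp add: antisym)
  then show "T x = x"
    using zero_iff mem by simp
qed

theorem theorem3p5:
  fixes X :: "'a set" and S :: "'a \<Rightarrow> 'a \<Rightarrow> 'a \<Rightarrow> real"
    and x0 :: 'a and r h :: real and \<phi> :: "'a \<Rightarrow> real" and T :: "'a \<Rightarrow> 'a"
  assumes "S_metric_space X S"
    and "x0 \<in> X" and "0 < r"
    and "\<And>x. x \<in> X \<Longrightarrow> \<phi> x = S x x x0"
    and "T \<in> X \<rightarrow> X"
    and "\<And>x. x \<in> X \<Longrightarrow> S_diam S (iterates T x) < \<infinity>"
    and "0 \<le> h" and "h < 1"
    and "\<And>x. x \<in> S_circle X S x0 r \<Longrightarrow> S x x (T x) \<le> \<phi> x - \<phi> (T x)"
    and "\<And>x. x \<in> S_circle X S x0 r \<Longrightarrow> h * S x x (T x) + S (T x) (T x) x0 \<ge> r"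
    and "circle_contractive X S T x0 r"
  shows "fixed_circle X S T x0 r \<and>
    (S_circle X S x0 r \<noteq> {} \<longrightarrow>
      (\<forall>x1 \<in> X. \<forall>\<rho> > 0.
        fixed_circle X S T x1 \<rho> \<and> S_circle X S x1 \<rho> \<noteq> {} \<and>
        (\<not> S_circle X S x1 \<rho> \<subset> S_circle X S x0 r \<or> circle_contractive X S T x1 \<rho>)
        \<longrightarrow> S_circle X S x1 \<rho> = S_circle X S x0 r))"
proof -
  interpret S_metric_space X S
    by (fact assms(1))
  have fixed: "fixed_circle X S T x0 r"
  proof (rule fixed_circleI)
    fix x assume x: "x \<in> S_circle X S x0 r"
    then have "x \<in> X" "T x \<in> X"
      using assms(5) by (auto simp: S_circle_def)
    then show "S x x (T x) \<le> S x x x0 - S (T x) (T x) x0"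
      using assms(9)[OF x] by (simp add: assms(4))
  qed (use assms in auto)
  moreover have "S_circle X S x1 \<rho> = S_circle X S x0 r"
    if "S_circle X S x0 r \<noteq> {}"
      and other: "fixed_circle X S T x1 \<rho>" "S_circle X S x1 \<rho> \<noteq> {}"
      and proper: "\<not> S_circle X S x1 \<rho> \<subset> S_circle X S x0 r \<or> circle_contractive X S T x1 \<rho>"
    for x1 \<rho>
  proof -
    have "S_circle X S x1 \<rho> \<subseteq> S_circle X S x0 r"
      using fixed that(1) assms(11) other(1)
      by (rule fixed_circle_subset_contractive_fixed_circle)
    moreover have "S_circle X S x0 r \<subseteq> S_circle X S x1 \<rho>"
      if "circle_contractive X S T x1 \<rho>"
      using other that fixed by (rule fixed_circle_subset_contractive_fixed_circle)
    ultimately show ?thesis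
      using proper by blast
  qed
  ultimately show ?thesis
    by blast
qed

end
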